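(* For every integer $n \geq 1$, the number $Z(n)$ of (arbitrary) topologies $\mathcal{T}$ on $\{1,\ldots,n\}$ with covering dimension $\dim(\{1,\ldots,n\},\mathcal{T})=0$ satisfies \[ Z(n) = \sum_{\mathcal{P}\in \mathrm{Part}(n)} Z_{T_0}(|\mathcal{P}|), \] where $\mathrm{Part}(n)$ is the set of partitions of $\{1,\ldots,n\}$ and $Z_{T_0}(k)$ is the number of $T_0$-topologies $\mathcal{T}$ on $\{1,\ldots,k\}$ with $\dim(\{1,\ldots,k\},\mathcal{T})=0$.
   Context: A topology $\mathcal{T}$ on $X$ is $T_0$ if for any two distinct points $x,y$ there is an open set containing exactly one of them. A finite open covering of $(X,\mathcal{T})$ is a finite subset $\mathcal{A}\subseteq\mathcal{T}$ with $\bigcup\mathcal{A}=X$; $\mathcal{A}$ is finer than $\mathcal{B}$ if every $A\in\mathcal{A}$ is contained in some $B\in\mathcal{B}$. The order of a finite open covering $\mathcal{A}$ is the largest integer $m\geq -1$ such that $\mathcal{A}$ contains $m+1$ distinct sets with non-empty intersection. For $m\geq -1$, $\dim(X,\mathcal{T})\leq m$ means every finite open covering has a finer finite open covering of order $\leq m$; $\dim(X,\mathcal{T})=0$ means $\dim(X,\mathcal{T})\leq 0$ but not $\dim(X,\mathcal{T})\leq -1$ (the latter holds exactly for the empty space). *)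

theory Defs
  imports "HOL-Analysis.Analysis" "HOL-Library.Disjoint_Sets"
begin

definition finite_open_covering :: "'a topology \<Rightarrow> 'a set set \<Rightarrow> bool" where
  "finite_open_covering X \<A> \<longleftrightarrow> finite \<A> \<and> (\<forall>A\<in>\<A>. openin X A) \<and> \<Union>\<A> = topspace X"

definition finer_covering :: "'a set set \<Rightarrow> 'a set set \<Rightarrow> bool" where
  "finer_covering \<A> \<B> \<longleftrightarrow> (\<forall>A\<in>\<A>. \<exists>B\<in>\<B>. A \<subseteq> B)"

(* Only meaningful for finite coverings. The empty subfamily has non-empty
   intersection, as \<Inter>{} = UNIV, so that the maximum is always at least -1; it equals -1
   exactly for the coverings {} and {{}} of the empty space. *)
definition covering_order :: "'a set set \<Rightarrow> int" where
  "covering_order \<A> = Max {int (card \<F>) - 1 | \<F>. \<F> \<subseteq> \<A> \<and> \<Inter>\<F> \<noteq> {}}"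

(* Intended for m \<ge> -1. *)
definition covering_dim_le :: "'a topology \<Rightarrow> int \<Rightarrow> bool" where
  "covering_dim_le X m \<longleftrightarrow>
     (\<forall>\<A>. finite_open_covering X \<A> \<longrightarrow>
        (\<exists>\<B>. finite_open_covering X \<B> \<and> finer_covering \<B> \<A> \<and> covering_order \<B> \<le> m))"

definition covering_dim_zero :: "'a topology \<Rightarrow> bool" where
  "covering_dim_zero X \<longleftrightarrow> covering_dim_le X 0 \<and> \<not> covering_dim_le X (-1)"

definition num_dim_zero :: "nat \<Rightarrow> nat" where
  "num_dim_zero n = card {X :: nat topology. topspace X = {1..n} \<and> covering_dim_zero X}"

definition num_T0_dim_zero :: "nat \<Rightarrow> nat" where
  "num_T0_dim_zero k =
     card {X :: nat topology. topspace X = {1..k} \<and> t0_space X \<and> covering_dim_zero X}"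

lemma covering_order_le_iff:
  assumes "finite \<A>"
  shows "covering_order \<A> \<le> m \<longleftrightarrow>
    (\<forall>\<F>. \<F> \<subseteq> \<A> \<longrightarrow> \<Inter>\<F> \<noteq> {} \<longrightarrow> int (card \<F>) - 1 \<le> m)"
proof -
  let ?S = "{int (card \<F>) - 1 | \<F>. \<F> \<subseteq> \<A> \<and> \<Inter>\<F> \<noteq> {}}"
  have "?S \<subseteq> (\<lambda>\<F>. int (card \<F>) - 1) ` Pow \<A>" by blast
  then have fin: "finite ?S" using assms by (simp add: finite_subset)
  have "int (card ({} :: 'a set set)) - 1 \<in> ?S" by blast
  then have ne: "?S \<noteq> {}" by blast
  show ?thesis
    unfolding covering_order_def Max_le_iff[OF fin ne] by blast
qed

lemma covering_dim_le_minus_1_iff: "covering_dim_le X (-1) \<longleftrightarrow> topspace X = {}"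
proof
  assume "covering_dim_le X (-1)"
  moreover have "finite_open_covering X {topspace X}"
    by (simp add: finite_open_covering_def)
  ultimately obtain \<B> where B: "finite_open_covering X \<B>" "covering_order \<B> \<le> -1"
    unfolding covering_dim_le_def by blast
  then have fin: "finite \<B>" and Un: "\<Union>\<B> = topspace X"
    by (auto simp: finite_open_covering_def)
  have "B = {}" if "B \<in> \<B>" for B
  proof (rule ccontr)
    assume "B \<noteq> {}"
    with that have "{B} \<subseteq> \<B>" "\<Inter>{B} \<noteq> {}" by simp_all
    with B(2) have "int (card {B}) - 1 \<le> -1"
      unfolding covering_order_le_iff[OF fin] by blast
    then show False by simp
  qed
  with Un show "topspace X = {}" by blast
next
  assume "topspace X = {}"
  then have "finite_open_covering X {}" "covering_order ({} :: 'a set set) \<le> -1"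
    by (simp_all add: finite_open_covering_def covering_order_le_iff)
  then show "covering_dim_le X (-1)"
    unfolding covering_dim_le_def finer_covering_def by blast
qed

end

theory Submission
  imports Defs
begin

text \<open>
  Points contained in the same open sets form an equivalence relation. A topology on a set
  \<open>S\<close> is the same as its indistinguishability relation together with a \<open>T\<^sub>0\<close> topology on the
  set of classes, namely the one of which it is the pullback along the quotient map. Pulling back
  along a surjection is an isomorphism of the lattices of open sets which moreover preserves
  non-emptiness of intersections, so it does not change the covering dimension.
\<close>

section \<open>Indistinguishability, finiteness, and relations given by partitions\<close>

definition indistinguishable :: "'a topology \<Rightarrow> ('a \<times> 'a) set" where
  "indistinguishable X =
     {(x, y). x \<in> topspace X \<and> y \<in> topspace X \<and> (\<forall>U. openin X U \<longrightarrow> (x \<in> U \<longleftrightarrow> y \<in> U))}"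

lemma equiv_indistinguishable: "equiv (topspace X) (indistinguishable X)"
  by (rule equivI) (auto simp: indistinguishable_def refl_on_def sym_def trans_def)

text \<open>A topology is determined by its family of open sets, here an element of
  \<open>Pow (Pow S)\<close>. Finiteness is what later allows cardinalities to be added over a
  disjoint union.\<close>

lemma finite_topologies_on:
  assumes "finite S"
  shows "finite {X. topspace X = S}"
proof (rule finite_imageD)
  show "finite ((\<lambda>X. {U. openin X U}) ` {X. topspace X = S})"
    by (rule finite_subset[where B = "Pow (Pow S)"]) (use assms openin_subset in \<open>fastforce+\<close>)
  show "inj_on (\<lambda>X. {U. openin X U}) {X. topspace X = S}"
    by (auto simp: inj_on_def topology_eq)
qed

lemma finite_open_covering_subset_Pow:
  "finite_open_covering X \<A> \<Longrightarrow> \<A> \<subseteq> Pow (topspace X)"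
  by (auto simp: finite_open_covering_def)

text \<open>Passing to classes and back loses nothing. This places a topology in the summand indexed
  by its own indistinguishability classes.\<close>

lemma partition_on_relation_quotient:
  assumes "equiv A r"
  shows "{(x, y). \<exists>p \<in> A // r. x \<in> p \<and> y \<in> p} = r"
proof (intro set_eqI iffI; clarify)
  fix x y p assume "p \<in> A // r" "x \<in> p" "y \<in> p"
  then show "(x, y) \<in> r"
    using quotient_eq_iff[OF assms] by blast
next
  fix x y assume "(x, y) \<in> r"
  moreover from this have "x \<in> A"
    using assms by (auto simp: equiv_def)
  ultimately show "\<exists>p \<in> A // r. x \<in> p \<and> y \<in> p"
    using assms equiv_class_self[OF assms] by (intro bexI[of _ "r `` {x}"]) (auto simp: quotientI)
qed

section \<open>Pullback along a surjection: coverings, order and dimension\<close>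

context
  fixes q :: "'a \<Rightarrow> 'b" and S :: "'a set" and T :: "'b set"
  assumes q_image: "q ` S = T"
begin

text \<open>By surjectivity, taking the image under \<open>q\<close> is a left inverse.\<close>

lemma vimage_surj_inj: "inj_on (\<lambda>U. q -` U \<inter> S) (Pow T)"
proof (rule inj_on_inverseI)
  show "q ` (q -` U \<inter> S) = U" if "U \<in> Pow T" for U
    using that q_image by auto
qed

text \<open>Openness in the pullback only provides some open set of \<open>Y\<close> with the same
  preimage; injectivity forces that set to be \<open>U\<close>.\<close>

lemma openin_pullback_surj_iff:
  assumes "topspace Y = T" "U \<subseteq> T"
  shows "openin (pullback_topology S q Y) (q -` U \<inter> S) \<longleftrightarrow> openin Y U"
  unfolding openin_pullback_topology
  using assms vimage_surj_inj[THEN inj_onD] openin_subset by (metis PowI)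

lemma finite_open_covering_image_vimage_iff:
  assumes Y: "topspace Y = T" and "\<A> \<subseteq> Pow T"
  shows "finite_open_covering (pullback_topology S q Y) ((\<lambda>U. q -` U \<inter> S) ` \<A>)
    \<longleftrightarrow> finite_open_covering Y \<A>"
proof -
  have inj: "inj_on (\<lambda>U. q -` U \<inter> S) \<A>"
    using vimage_surj_inj assms(2) by (rule inj_on_subset)
  have "\<Union>((\<lambda>U. q -` U \<inter> S) ` \<A>) = q -` \<Union>\<A> \<inter> S"
    by auto
  \<comment> \<open>Preimages commute with unions, so covering \<open>S\<close> and covering
    \<open>T\<close> are compared by injectivity applied to the whole union.\<close>
  moreover have "q -` \<Union>\<A> \<inter> S = q -` T \<inter> S \<longleftrightarrow> \<Union>\<A> = T"
    using vimage_surj_inj[THEN inj_on_eq_iff, of "\<Union>\<A>" T] assms(2) by auto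
  moreover have "(\<forall>A\<in>(\<lambda>U. q -` U \<inter> S) ` \<A>. openin (pullback_topology S q Y) A)
      \<longleftrightarrow> (\<forall>U\<in>\<A>. openin Y U)"
    using assms(2) openin_pullback_surj_iff[OF Y] by blast
  ultimately show ?thesis
    by (simp only: finite_open_covering_def topspace_pullback_topology Y finite_image_iff[OF inj])
qed

text \<open>Every open set of the pullback is a preimage by definition, so a covering of
  \<open>S\<close> descends to \<open>T\<close>. This handles the quantifiers over all coverings in
  the definition of dimension.\<close>

lemma finite_open_covering_pullbackE:
  assumes "topspace Y = T" and "finite_open_covering (pullback_topology S q Y) \<A>"
  obtains \<B> where "\<B> \<subseteq> Pow T" "\<A> = (\<lambda>U. q -` U \<inter> S) ` \<B>" "finite_open_covering Y \<B>"
proof -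
  have "\<A> \<subseteq> (\<lambda>U. q -` U \<inter> S) ` {U. openin Y U}"
    using assms(2) by (auto simp: finite_open_covering_def openin_pullback_topology)
  then obtain \<B> where B: "\<B> \<subseteq> {U. openin Y U}" "\<A> = (\<lambda>U. q -` U \<inter> S) ` \<B>"
    unfolding subset_image_iff by blast
  moreover have "\<B> \<subseteq> Pow T"
    using B(1) openin_subset assms(1) by blast
  ultimately show ?thesis
    using finite_open_covering_image_vimage_iff[OF assms(1), of \<B>] assms(2) by (intro that) auto
qed

text \<open>An inclusion of preimages descends once the smaller set lies in the image of
  \<open>q\<close>; hence the condition is on \<open>\<A>\<close>.\<close>

lemma finer_covering_image_vimage_iff:
  assumes "\<A> \<subseteq> Pow T"
  shows "finer_covering ((\<lambda>U. q -` U \<inter> S) ` \<A>) ((\<lambda>U. q -` U \<inter> S) ` \<B>) \<longleftrightarrow> finer_covering \<A> \<B>"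
proof -
  have "q -` U \<inter> S \<subseteq> q -` V \<inter> S \<longleftrightarrow> U \<subseteq> V" if "U \<in> \<A>" for U V
  proof -
    have "U \<subseteq> q ` S"
      using assms that q_image by auto
    then show ?thesis by blast
  qed
  then show ?thesis
    unfolding finer_covering_def by auto
qed

text \<open>Injectivity preserves the size of subfamilies, and a common point in \<open>T\<close>
  lifts to a common point in \<open>S\<close>. Both maxima are therefore taken over the same set of
  integers.\<close>

lemma covering_order_image_vimage:
  assumes "\<A> \<subseteq> Pow T"
  shows "covering_order ((\<lambda>U. q -` U \<inter> S) ` \<A>) = covering_order \<A>"
proof -
  have card: "card ((\<lambda>U. q -` U \<inter> S) ` \<F>) = card \<F>" if "\<F> \<subseteq> \<A>" for \<F>
    using that assms by (intro card_image inj_on_subset[OF vimage_surj_inj]) blast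
  have ne: "\<Inter>((\<lambda>U. q -` U \<inter> S) ` \<F>) \<noteq> {} \<longleftrightarrow> \<Inter>\<F> \<noteq> {}" if F: "\<F> \<subseteq> \<A>" for \<F>
  \<comment> \<open>The empty family is separate: its intersection is \<open>UNIV\<close> on both
    sides and need not lie in the image of \<open>q\<close>.\<close>
  proof (cases "\<F> = {}")
    case False
    then have "\<Inter>\<F> \<subseteq> q ` S"
      using F assms q_image by blast
    with False show ?thesis by blast
  qed simp
  let ?g = "\<lambda>U. q -` U \<inter> S"
  have "k \<in> {int (card \<F>) - 1 | \<F>. \<F> \<subseteq> ?g ` \<A> \<and> \<Inter>\<F> \<noteq> {}}
      \<longleftrightarrow> k \<in> {int (card \<F>) - 1 | \<F>. \<F> \<subseteq> \<A> \<and> \<Inter>\<F> \<noteq> {}}" for k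
  proof -
    have "k \<in> {int (card \<F>) - 1 | \<F>. \<F> \<subseteq> ?g ` \<A> \<and> \<Inter>\<F> \<noteq> {}}
        \<longleftrightarrow> (\<exists>\<F>\<subseteq>\<A>. k = int (card (?g ` \<F>)) - 1 \<and> \<Inter>(?g ` \<F>) \<noteq> {})"
      unfolding mem_Collect_eq subset_image_iff by blast
    also have "\<dots> \<longleftrightarrow> (\<exists>\<F>\<subseteq>\<A>. k = int (card \<F>) - 1 \<and> \<Inter>\<F> \<noteq> {})"
      using card ne by metis
    finally show ?thesis
      unfolding mem_Collect_eq by metis
  qed
  then show ?thesis
    unfolding covering_order_def by (intro arg_cong[where f = Max] set_eqI)
qed

text \<open>In each direction the given covering is carried to the other space, refined there, and
  the refinement is carried back with the same order.\<close>

lemma covering_dim_le_pullback: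
  assumes Y: "topspace Y = T"
  shows "covering_dim_le (pullback_topology S q Y) m \<longleftrightarrow> covering_dim_le Y m"
proof
  assume L: "covering_dim_le (pullback_topology S q Y) m"
  show "covering_dim_le Y m"
    unfolding covering_dim_le_def
  proof (intro allI impI)
    fix \<A> assume A: "finite_open_covering Y \<A>"
    then have "\<A> \<subseteq> Pow T"
      using finite_open_covering_subset_Pow Y by blast
    with A have "finite_open_covering (pullback_topology S q Y) ((\<lambda>U. q -` U \<inter> S) ` \<A>)"
      using finite_open_covering_image_vimage_iff[OF Y] by blast
    with L obtain \<C> where C: "finite_open_covering (pullback_topology S q Y) \<C>"
        "finer_covering \<C> ((\<lambda>U. q -` U \<inter> S) ` \<A>)" "covering_order \<C> \<le> m"
      unfolding covering_dim_le_def by blast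
    from finite_open_covering_pullbackE[OF Y C(1)] obtain \<B> where
      "\<B> \<subseteq> Pow T" "\<C> = (\<lambda>U. q -` U \<inter> S) ` \<B>" "finite_open_covering Y \<B>" .
    with C show "\<exists>\<B>. finite_open_covering Y \<B> \<and> finer_covering \<B> \<A> \<and> covering_order \<B> \<le> m"
      using finer_covering_image_vimage_iff[of \<B> \<A>] covering_order_image_vimage[of \<B>]
      by (intro exI[of _ \<B>]) simp
  qed
next
  assume R: "covering_dim_le Y m"
  show "covering_dim_le (pullback_topology S q Y) m"
    unfolding covering_dim_le_def
  proof (intro allI impI)
    fix \<C> assume "finite_open_covering (pullback_topology S q Y) \<C>"
    from finite_open_covering_pullbackE[OF Y this] obtain \<A> where
      A: "\<C> = (\<lambda>U. q -` U \<inter> S) ` \<A>" "finite_open_covering Y \<A>" .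
    with R obtain \<B> where B: "finite_open_covering Y \<B>" "finer_covering \<B> \<A>"
        "covering_order \<B> \<le> m"
      unfolding covering_dim_le_def by blast
    moreover have "\<B> \<subseteq> Pow T"
      using finite_open_covering_subset_Pow[OF B(1)] Y by simp
    ultimately show "\<exists>\<D>. finite_open_covering (pullback_topology S q Y) \<D> \<and>
        finer_covering \<D> \<C> \<and> covering_order \<D> \<le> m"
      unfolding A(1)
      using finite_open_covering_image_vimage_iff[OF Y, of \<B>]
        finer_covering_image_vimage_iff[of \<B> \<A>] covering_order_image_vimage[of \<B>]
      by (intro exI[of _ "(\<lambda>U. q -` U \<inter> S) ` \<B>"]) simp
  qed
qed

lemma covering_dim_zero_pullback:
  assumes "topspace Y = T"
  shows "covering_dim_zero (pullback_topology S q Y) \<longleftrightarrow> covering_dim_zero Y"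
  by (simp add: covering_dim_zero_def covering_dim_le_pullback[OF assms])

text \<open>Open sets of the pullback separate \<open>x\<close> and \<open>y\<close> exactly when
  open sets of \<open>Y\<close> separate \<open>q x\<close> and \<open>q y\<close>, which by T0
  means that these differ.\<close>

lemma indistinguishable_pullback_t0:
  assumes Y: "topspace Y = T" and "t0_space Y"
  shows "indistinguishable (pullback_topology S q Y) = {(x, y). x \<in> S \<and> y \<in> S \<and> q x = q y}"
proof -
  have "(\<forall>U. openin (pullback_topology S q Y) U \<longrightarrow> (x \<in> U \<longleftrightarrow> y \<in> U)) \<longleftrightarrow> q x = q y"
    if "x \<in> S" "y \<in> S" for x y
  proof -
    have "q x \<in> topspace Y" "q y \<in> topspace Y"
      using that q_image Y by auto
    then have "(\<forall>V. openin Y V \<longrightarrow> (q x \<in> V \<longleftrightarrow> q y \<in> V)) \<longleftrightarrow> q x = q y"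
      using \<open>t0_space Y\<close> unfolding t0_space_def by metis
    moreover have "(\<forall>U. openin (pullback_topology S q Y) U \<longrightarrow> (x \<in> U \<longleftrightarrow> y \<in> U))
        \<longleftrightarrow> (\<forall>V. openin Y V \<longrightarrow> (x \<in> q -` V \<inter> S \<longleftrightarrow> y \<in> q -` V \<inter> S))"
      unfolding openin_pullback_topology by metis
    ultimately show ?thesis
      using that by simp
  qed
  moreover have "topspace (pullback_topology S q Y) = S"
    using q_image Y by (auto simp: topspace_pullback_topology)
  ultimately show ?thesis
    unfolding indistinguishable_def by auto
qed

text \<open>The quotient topology along \<open>q\<close> works: open sets of \<open>X\<close> are
  unions of fibres of \<open>q\<close>, so \<open>q\<close> maps them to open sets and nothing is
  lost by pulling back.\<close>

lemma pullback_t0_surj: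
  assumes X: "topspace X = S"
    and rel: "indistinguishable X = {(x, y). x \<in> S \<and> y \<in> S \<and> q x = q y}"
  obtains Y where "topspace Y = T" "t0_space Y" "pullback_topology S q Y = X"
proof -
  \<comment> \<open>The open sets of the quotient topology on \<open>T\<close>.\<close>
  define P where "P U \<longleftrightarrow> U \<subseteq> T \<and> openin X (q -` U \<inter> S)" for U
  have "istopology P"
    unfolding istopology_def
  proof (intro conjI allI impI)
    fix U V assume "P U" "P V"
    moreover have "q -` (U \<inter> V) \<inter> S = (q -` U \<inter> S) \<inter> (q -` V \<inter> S)"
      by blast
    ultimately show "P (U \<inter> V)"
      by (auto simp: P_def)
  next
    fix \<K> assume K: "\<forall>U\<in>\<K>. P U"
    have "q -` \<Union>\<K> \<inter> S = (\<Union>U\<in>\<K>. q -` U \<inter> S)"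
      by blast
    moreover from K have "openin X (\<Union>U\<in>\<K>. q -` U \<inter> S)"
      unfolding P_def by (intro openin_Union) blast
    ultimately show "P (\<Union>\<K>)"
      using K unfolding P_def by (simp only: Union_least simp_thms)
  qed
  define Y where "Y = topology P"
  have openY: "openin Y U \<longleftrightarrow> U \<subseteq> T \<and> openin X (q -` U \<inter> S)" for U
    using topology_inverse'[OF \<open>istopology P\<close>] by (simp add: Y_def P_def)
  have "q -` T \<inter> S = S"
    using q_image by blast
  then have "openin Y T"
    using X openin_topspace[of X] by (simp add: openY)
  then have top: "topspace Y = T"
    using openY openin_subset openin_topspace by (metis subset_antisym)
  \<comment> \<open>With a point \<open>u\<close>, an open set contains every point
    indistinguishable from \<open>u\<close>, which by \<open>rel\<close> is the whole fibre of
    \<open>q\<close> through \<open>u\<close>.\<close>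
  have saturated: "q -` (q ` U) \<inter> S = U" if "openin X U" for U
  proof
    show "q -` (q ` U) \<inter> S \<subseteq> U"
    proof
      fix x assume x: "x \<in> q -` (q ` U) \<inter> S"
      then obtain u where u: "u \<in> U" "q x = q u" "x \<in> S"
        by auto
      then have "(x, u) \<in> indistinguishable X"
        using openin_subset[OF that] by (auto simp: rel X)
      then show "x \<in> U"
        using that u by (auto simp: indistinguishable_def)
    qed
    show "U \<subseteq> q -` (q ` U) \<inter> S"
      using openin_subset[OF that] X by blast
  qed
  have image_open: "openin Y (q ` U)" if "openin X U" for U
    using saturated[OF that] openin_subset[OF that] that X q_image by (auto simp: openY)
  have "t0_space Y"
    unfolding t0_space_def top
  proof (intro ballI impI)
    fix a b assume "a \<in> T" "b \<in> T" "a \<noteq> b"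
    then obtain x y where xy: "x \<in> S" "y \<in> S" "a = q x" "b = q y"
      using q_image by blast
    with \<open>a \<noteq> b\<close> have "(x, y) \<notin> indistinguishable X"
      by (simp add: rel)
    with xy X obtain U where U: "openin X U" "x \<in> U \<longleftrightarrow> y \<notin> U"
      by (auto simp: indistinguishable_def)
    \<comment> \<open>Saturation lets the image of \<open>U\<close> separate \<open>a\<close> from
      \<open>b\<close> just as \<open>U\<close> separates \<open>x\<close> from
      \<open>y\<close>.\<close>
    have "q z \<in> q ` U \<longleftrightarrow> z \<in> U" if "z \<in> S" for z
      using eqset_imp_iff[OF saturated[OF U(1)], of z] that by simp
    with xy U(2) have "a \<notin> q ` U \<longleftrightarrow> b \<in> q ` U"
      by simp
    with image_open[OF U(1)] show "\<exists>V. openin Y V \<and> (a \<notin> V \<longleftrightarrow> b \<in> V)"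
      by (intro exI conjI)
  qed
  moreover have "pullback_topology S q Y = X"
    unfolding topology_eq openin_pullback_topology
  proof (intro allI iffI)
    fix U assume "openin X U"
    then show "\<exists>V. openin Y V \<and> U = q -` V \<inter> S"
      using image_open saturated by (intro exI[of _ "q ` U"]) simp
  qed (auto simp: openY)
  ultimately show ?thesis
    using that top by blast
qed

text \<open>The counting step for one fixed relation, the kernel of \<open>q\<close>: surjectivity
  comes from the quotient topology, and dimension zero passes both ways.\<close>

lemma bij_betw_pullback_t0:
  "bij_betw (pullback_topology S q)
     {Y. topspace Y = T \<and> t0_space Y \<and> covering_dim_zero Y}
     {X. topspace X = S \<and> indistinguishable X = {(x, y). x \<in> S \<and> y \<in> S \<and> q x = q y} \<and>
         covering_dim_zero X}"
  (is "bij_betw _ ?A ?B")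
proof (rule bij_betw_imageI)
  show "inj_on (pullback_topology S q) ?A"
  proof (rule inj_onI)
    fix Y Z
    assume "Y \<in> ?A" "Z \<in> ?A" and eq: "pullback_topology S q Y = pullback_topology S q Z"
    then have YZ: "topspace Y = T" "topspace Z = T"
      by auto
    \<comment> \<open>Open sets of \<open>Y\<close> and \<open>Z\<close> all lie in
      \<open>T\<close>, so comparing subsets of \<open>T\<close> suffices.\<close>
    have "openin Y U \<longleftrightarrow> openin Z U" if "U \<subseteq> T" for U
      using openin_pullback_surj_iff[OF YZ(1) that] openin_pullback_surj_iff[OF YZ(2) that]
      by (simp add: eq)
    then show "Y = Z"
      unfolding topology_eq using openin_subset YZ by metis
  qed
  have "q -` T \<inter> S = S"
    using q_image by blast
  then have "pullback_topology S q ` ?A \<subseteq> ?B"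
    using covering_dim_zero_pullback indistinguishable_pullback_t0
    by (auto simp: topspace_pullback_topology)
  moreover have "?B \<subseteq> pullback_topology S q ` ?A"
  proof
    fix X assume "X \<in> ?B"
    then have X: "topspace X = S"
        "indistinguishable X = {(x, y). x \<in> S \<and> y \<in> S \<and> q x = q y}" "covering_dim_zero X"
      by auto
    obtain Y where Y: "topspace Y = T" "t0_space Y" "pullback_topology S q Y = X"
      by (rule pullback_t0_surj[OF X(1,2)])
    moreover from this X(3) have "covering_dim_zero Y"
      using covering_dim_zero_pullback by blast
    ultimately show "X \<in> pullback_topology S q ` ?A"
      by blast
  qed
  ultimately show "pullback_topology S q ` ?A = ?B"
    by blast
qed

end

text \<open>Number the blocks and send each point to the number of its block. The target is
  \<open>{1..card P}\<close> because T0 topologies are counted on such sets.\<close>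

lemma partition_on_class_map:
  assumes "finite S" and P: "partition_on S P"
  obtains q :: "'a \<Rightarrow> nat" where "q ` S = {1..card P}"
    "{(x, y). x \<in> S \<and> y \<in> S \<and> q x = q y} = {(x, y). \<exists>p \<in> P. x \<in> p \<and> y \<in> p}"
proof -
  have "finite P"
    using finite_elements[OF assms] .
  then obtain h where h: "bij_betw h P {1..card P}"
    using ex_bij_betw_finite_nat[of P] bij_betw_iff_card[of P "{1..card P}"] by auto
  have S: "S = \<Union>P" and "{} \<notin> P"
    using partition_onD1[OF P] partition_onD3[OF P] .
  then have "\<forall>x\<in>S. \<exists>p. p \<in> P \<and> x \<in> p"
    by blast
  then obtain c where "\<forall>x\<in>S. c x \<in> P \<and> x \<in> c x"
    by (rule bchoice[THEN exE])
  then have c: "c x \<in> P" "x \<in> c x" if "x \<in> S" for x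
    using that by blast+
  \<comment> \<open>Blocks are pairwise disjoint, so the chosen block \<open>c x\<close> is the only
    one containing \<open>x\<close>.\<close>
  have c_eq: "c x = p" if "p \<in> P" "x \<in> p" for x p
  proof -
    have "x \<in> S" using that S by blast
    then have "\<not> disjnt (c x) p" using c that by (auto simp: disjnt_iff)
    then show ?thesis
      using partition_onD2[OF P] c(1)[OF \<open>x \<in> S\<close>] that(1) by (auto simp: pairwise_def)
  qed
  have "c ` S = P"
  proof
    show "P \<subseteq> c ` S"
    proof
      fix p assume "p \<in> P"
      with \<open>{} \<notin> P\<close> obtain x where "x \<in> p" by fastforce
      with \<open>p \<in> P\<close> c_eq S show "p \<in> c ` S" by blast
    qed
  qed (use c in blast)
  then have "(h \<circ> c) ` S = {1..card P}"
    using h by (simp only: image_comp[symmetric] bij_betw_def)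
  moreover have "x \<in> S \<and> y \<in> S \<and> (h \<circ> c) x = (h \<circ> c) y \<longleftrightarrow> (\<exists>p \<in> P. x \<in> p \<and> y \<in> p)" for x y
  proof
    assume xy: "x \<in> S \<and> y \<in> S \<and> (h \<circ> c) x = (h \<circ> c) y"
    then have "c x = c y"
      using bij_betw_imp_inj_on[OF h] c(1) by (auto dest: inj_onD)
    then show "\<exists>p \<in> P. x \<in> p \<and> y \<in> p"
      using xy c by metis
  next
    assume "\<exists>p \<in> P. x \<in> p \<and> y \<in> p"
    then show "x \<in> S \<and> y \<in> S \<and> (h \<circ> c) x = (h \<circ> c) y"
      using c_eq S by fastforce
  qed
  ultimately show ?thesis
    using that[of "h \<circ> c"] by simp
qed

section \<open>Counting topologies by their indistinguishability classes\<close>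

theorem theorem3:
  fixes n :: nat
  assumes "n \<ge> 1"
  shows "num_dim_zero n = (\<Sum>P\<in>{P. partition_on {1..n} P}. num_T0_dim_zero (card P))"
proof -
  let ?S = "{1..n}"
  define rel where "rel P = {(x, y). \<exists>p \<in> P. x \<in> p \<and> y \<in> p}" for P :: "nat set set"
  \<comment> \<open>The summand of \<open>P\<close>: topologies whose indistinguishability classes
    are the blocks of \<open>P\<close>.\<close>
  define F where "F P = {X. topspace X = ?S \<and> indistinguishable X = rel P \<and> covering_dim_zero X}"
    for P
  have fin: "finite (F P)" for P
    using finite_topologies_on[of ?S] by (rule finite_subset[rotated]) (auto simp: F_def)
  \<comment> \<open>A partition is recovered as the quotient by its relation, so distinct partitions
    have distinct relations.\<close>
  have disj: "F P \<inter> F Q = {}" if "partition_on ?S P" "partition_on ?S Q" "P \<noteq> Q" for P Q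
    using partition_on_eq_quotient[OF that(1)] partition_on_eq_quotient[OF that(2)] that(3)
    unfolding F_def rel_def[symmetric] by auto
  \<comment> \<open>With \<open>q\<close> numbering the blocks, \<open>rel P\<close> is the kernel
    of \<open>q\<close>, and the pullback bijection leaves a count depending only on the number of
    blocks.\<close>
  have card_F: "card (F P) = num_T0_dim_zero (card P)" if P: "partition_on ?S P" for P
  proof -
    obtain q where q: "q ` ?S = {1..card P}"
        "{(x, y). x \<in> ?S \<and> y \<in> ?S \<and> q x = q y} = rel P"
      using partition_on_class_map[OF _ P] unfolding rel_def by blast
    show ?thesis
      using bij_betw_same_card[OF bij_betw_pullback_t0[OF q(1)]]
      unfolding q(2) F_def num_T0_dim_zero_def by simp
  qed
  have "{X. topspace X = ?S \<and> covering_dim_zero X} = (\<Union>P\<in>{P. partition_on ?S P}. F P)"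
  proof (intro subset_antisym subsetI)
    fix X assume X: "X \<in> {X. topspace X = ?S \<and> covering_dim_zero X}"
    then have "equiv ?S (indistinguishable X)"
      using equiv_indistinguishable[of X] by simp
    \<comment> \<open>The index for \<open>X\<close> is the partition into its own
      indistinguishability classes.\<close>
    from partition_on_quotient[OF this] partition_on_relation_quotient[OF this] X
    show "X \<in> (\<Union>P\<in>{P. partition_on ?S P}. F P)"
      unfolding F_def rel_def by (intro UN_I[of "?S // indistinguishable X"]) auto
  qed (auto simp: F_def)
  then have "num_dim_zero n = card (\<Union>P\<in>{P. partition_on ?S P}. F P)"
    by (simp add: num_dim_zero_def)
  also have "\<dots> = (\<Sum>P\<in>{P. partition_on ?S P}. card (F P))"
    using finitely_many_partition_on[of ?S] fin disj by (intro card_UN_disjoint) auto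
  also have "\<dots> = (\<Sum>P\<in>{P. partition_on ?S P}. num_T0_dim_zero (card P))"
    using card_F by (intro sum.cong) auto
  finally show ?thesis .
qed

end
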